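(* For every $k \in \mathbb{N}$ there exists a strongly $k$-connected digraph $D_k$ which contains no two arc-disjoint directed cycles (and hence no two vertex-disjoint directed cycles) of equal length.
   Context: $\mathbb{N}$ denotes the positive integers. Digraphs are finite, have no loops and no parallel arcs, but may contain anti-parallel pairs of arcs (digons, which count as directed cycles of length $2$). A digraph $D$ is strongly connected if for every ordered pair $(x,y)$ of vertices there is a directed path from $x$ to $y$. For an integer $k\ge 1$, $D$ is strongly $k$-connected if $|V(D)| \ge k+1$ and for every set $S\subseteq V(D)$ of at most $k-1$ vertices, the digraph $D-S$ is strongly connected. The length of a directed cycle is its number of arcs. *)

theory Defs
  imports "Graph_Theory.Graph_Theory"
begin

(* For k >= 1, "card S < k" says that S has at most k - 1 elements. The bound on card (verts D)
   is positive, so it forces verts D, and hence every such S, to be finite. *)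
definition strongly_k_connected :: "nat \<Rightarrow> ('a, 'b) pre_digraph \<Rightarrow> bool" where
  "strongly_k_connected k D \<longleftrightarrow>
     k + 1 \<le> card (verts D) \<and>
     (\<forall>S. S \<subseteq> verts D \<and> card S < k \<longrightarrow> strongly_connected (D \<restriction> (verts D - S)))"

definition walk_verts :: "('a, 'b) pre_digraph \<Rightarrow> 'b awalk \<Rightarrow> 'a set" where
  "walk_verts D p = tail D ` set p \<union> head D ` set p"

definition arc_disjoint :: "'b awalk \<Rightarrow> 'b awalk \<Rightarrow> bool" where
  "arc_disjoint p q \<longleftrightarrow> set p \<inter> set q = {}"

definition vertex_disjoint :: "('a, 'b) pre_digraph \<Rightarrow> 'b awalk \<Rightarrow> 'b awalk \<Rightarrow> bool" where
  "vertex_disjoint D p q \<longleftrightarrow> walk_verts D p \<inter> walk_verts D q = {}"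

end

theory Submission
  imports Defs "HOL-Library.Nat_Bijection"
begin

text \<open>
  Take layers \<open>0, \<dots>, 2B\<close> of \<open>k\<close> vertices each, where \<open>B = 2\<^sup>n\<close> and \<open>n = 2k\<^sup>2\<close>, with all arcs from
  each layer to the next one, and add \<open>n\<close> backward arcs, the \<open>m\<close>-th of which descends
  \<open>B + 2\<^sup>m - 1\<close> layers: \<open>k\<close> of them enter each vertex of the bottom layer and \<open>k\<close> of them leave each
  vertex of the top layer. In a cycle the ascents and descents balance, so the \<open>m\<close>-th backward arc
  accounts for \<open>B + 2\<^sup>m\<close> arcs. Hence the length modulo \<open>B\<close>, read in binary, is the set of
  backward arcs on the cycle, and two cycles of equal length share a backward arc.

  Deleting fewer than \<open>k\<close> vertices leaves a vertex in each layer, an arc from each top vertex to a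
  layer below \<open>B\<close>, and an arc to each bottom vertex from a layer at or above \<open>B\<close>; going up, down,
  up and down again leads from any vertex to any other.
\<close>

section \<open>Construction of the layered digraph\<close>

definition depth :: "nat \<Rightarrow> nat" where
  "depth k = 2 ^ (2 * (k * k))"

text \<open>Indices come in blocks of \<open>k\<close>: a block below \<open>k * k\<close> shares a
  head in the bottom layer, and a later block shares a tail in the top layer. The other end is
  always the first vertex of its layer; that layer changes with \<open>m\<close>, so the
  \<open>k\<close> other ends in a block are distinct.\<close>

definition back_arc :: "nat \<Rightarrow> nat \<Rightarrow> nat \<times> nat" where
  "back_arc k m =
     (if m < k * k then ((depth k + 2 ^ m - 1) * k, m div k)
      else (2 * depth k * k + (m - k * k) div k, (depth k + 1 - 2 ^ m) * k))"

text \<open>Vertex \<open>v\<close> lies in layer \<open>v div k\<close>.\<close>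

definition layered_digraph :: "nat \<Rightarrow> (nat, nat \<times> nat) pre_digraph" where
  "layered_digraph k =
     \<lparr>verts = {..<(2 * depth k + 1) * k},
      arcs = {(u, v). u < (2 * depth k + 1) * k \<and> v < (2 * depth k + 1) * k \<and> v div k = u div k + 1}
        \<union> back_arc k ` {..<2 * (k * k)},
      tail = fst, head = snd\<rparr>"

lemma layered_digraph_simps [simp]:
  "verts (layered_digraph k) = {..<(2 * depth k + 1) * k}"
  "tail (layered_digraph k) = fst"
  "head (layered_digraph k) = snd"
  by (simp_all add: layered_digraph_def)

text \<open>Keeps the ends of back arcs within the layers \<open>0\<close> to
  \<open>2 * depth k\<close>, and the subtraction in \<open>back_arc\<close> from
  truncating.\<close>

lemma two_power_le_depth:
  assumes "m < 2 * (k * k)"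
  shows "2 * 2 ^ m \<le> depth k"
proof -
  have "(2::nat) ^ Suc m \<le> 2 ^ (2 * (k * k))"
    using assms by (intro power_increasing) auto
  then show ?thesis by (simp add: depth_def)
qed

lemma div_add_layer:
  fixes a i k :: nat
  assumes "i < k"
  shows "(a * k + i) div k = a"
  using assms by simp

lemma layer_less_iff:
  fixes a k v :: nat
  assumes "0 < k"
  shows "v < (a + 1) * k \<longleftrightarrow> v div k \<le> a"
  using div_less_iff_less_mult[OF assms, of v "a + 1"] by auto

lemma back_arc_in_verts:
  assumes "0 < k" "m < 2 * (k * k)"
  shows "fst (back_arc k m) < (2 * depth k + 1) * k" "snd (back_arc k m) < (2 * depth k + 1) * k"
proof -
  have m: "2 * 2 ^ m \<le> depth k" by (rule two_power_le_depth) fact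
  have "(1::nat) \<le> 2 ^ m" by simp
  with m have d: "depth k + 1 - 2 ^ m \<le> 2 * depth k" by linarith
  have k: "m < k * k \<Longrightarrow> m div k < k" "(m - k * k) div k < k"
    using assms by (auto simp: div_less_iff_less_mult)
  show "fst (back_arc k m) < (2 * depth k + 1) * k"
    unfolding layer_less_iff[OF assms(1)] using m d k assms by (auto simp: back_arc_def)
  show "snd (back_arc k m) < (2 * depth k + 1) * k"
    unfolding layer_less_iff[OF assms(1)] using m d k assms by (auto simp: back_arc_def)
qed

text \<open>Difference of the potential \<open>v div k\<close> along an arc, hence of sum zero
  around a cycle.\<close>

definition descent :: "nat \<Rightarrow> nat \<times> nat \<Rightarrow> int" where
  "descent k e = int (fst e div k) - int (snd e div k)"

text \<open>The \<open>+ 1\<close> counts the back arc itself, in addition to the forward arcs that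
  regain the lost layers.\<close>

lemma descent_back_arc:
  assumes "0 < k" "m < 2 * (k * k)"
  shows "descent k (back_arc k m) + 1 = int (depth k) + 2 ^ m"
proof -
  define P :: nat where "P = 2 ^ m"
  have P: "int P = 2 ^ m" "1 \<le> P" "2 * P \<le> depth k"
    using two_power_le_depth[OF assms(2)] by (simp_all add: P_def)
  have k: "m < k * k \<Longrightarrow> m div k < k" "(m - k * k) div k < k"
    using assms by (auto simp: div_less_iff_less_mult)
  show ?thesis
  proof (cases "m < k * k")
    case True
    then have "fst (back_arc k m) div k = depth k + P - 1" "snd (back_arc k m) div k = 0"
      using k(1) assms(1) by (simp_all add: back_arc_def P_def)
    then show ?thesis using P unfolding descent_def by linarith
  next
    case False
    then have "fst (back_arc k m) div k = 2 * depth k" "snd (back_arc k m) div k = depth k + 1 - P"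
      using k(2) assms(1) by (simp_all add: back_arc_def P_def div_add_layer)
    then show ?thesis using P unfolding descent_def by linarith
  qed
qed

text \<open>The descent of a back arc determines \<open>2 ^ m\<close>, and so the index.\<close>

lemma inj_on_back_arc:
  assumes "0 < k"
  shows "inj_on (back_arc k) {..<2 * (k * k)}"
proof (rule inj_onI)
  fix m n assume mn: "m \<in> {..<2 * (k * k)}" "n \<in> {..<2 * (k * k)}" "back_arc k m = back_arc k n"
  have "int (depth k) + 2 ^ m = descent k (back_arc k m) + 1"
    using mn(1) by (subst descent_back_arc[OF assms]) simp_all
  also have "\<dots> = int (depth k) + 2 ^ n"
    unfolding mn(3) using mn(2) by (intro descent_back_arc[OF assms]) simp
  finally show "m = n" by simp
qed

lemma arcs_layered_digraph_cases:
  assumes "0 < k" "e \<in> arcs (layered_digraph k)"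
  obtains "descent k e = -1" "e \<notin> back_arc k ` {..<2 * (k * k)}"
  | m where "m < 2 * (k * k)" "e = back_arc k m"
proof (cases "e \<in> back_arc k ` {..<2 * (k * k)}")
  case True
  then show ?thesis using that(2) by auto
next
  case False
  then have "snd e div k = fst e div k + 1"
    using assms(2) by (auto simp: layered_digraph_def)
  then show ?thesis using that(1) False by (simp add: descent_def)
qed

lemma digraph_layered_digraph:
  assumes "0 < k"
  shows "digraph (layered_digraph k)"
proof
  let ?D = "layered_digraph k"
  fix e assume e: "e \<in> arcs ?D"
  show "tail ?D e \<in> verts ?D" "head ?D e \<in> verts ?D"
    using e back_arc_in_verts[OF assms] by (auto simp: layered_digraph_def)
  \<comment> \<open>A loop would have descent 0, whereas forward arcs have descent -1 and back arcs
    a positive one.\<close>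
  have "descent k e \<noteq> 0"
    using assms e
  proof (cases rule: arcs_layered_digraph_cases)
    case (2 m)
    have "(0::nat) < 2 ^ m" by simp
    then have "2 \<le> depth k" using two_power_le_depth[OF 2(1)] by linarith
    moreover have "(0::int) < 2 ^ m" by simp
    ultimately have "descent k (back_arc k m) \<noteq> 0" using descent_back_arc[OF assms 2(1)] by linarith
    then show ?thesis using 2(2) by simp
  qed simp
  then show "tail ?D e \<noteq> head ?D e" by (auto simp: descent_def)
next
  let ?V = "verts (layered_digraph k)"
  show "finite ?V" by simp
  have "e \<in> ?V \<times> ?V" if "e \<in> arcs (layered_digraph k)" for e
    using that back_arc_in_verts[OF assms] by (auto simp: layered_digraph_def mem_Times_iff)
  then have "arcs (layered_digraph k) \<subseteq> ?V \<times> ?V" by blast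
  then show "finite (arcs (layered_digraph k))"
    by (rule finite_subset) simp
qed (simp add: arc_to_ends_def prod_eq_iff)

section \<open>Lengths of cycles\<close>

lemma (in pre_digraph) cas_sum_list_telescope:
  fixes f :: "'a \<Rightarrow> 'c :: ab_group_add"
  assumes "cas u p v"
  shows "(\<Sum>e\<leftarrow>p. f (tail G e) - f (head G e)) = f u - f v"
  using assms by (induction p arbitrary: u) auto

text \<open>A cycle repeats no arc, so the sum over its arc set is the sum along the closed walk,
  which telescopes.\<close>

lemma (in pre_digraph) cycle_sum_potential:
  fixes f :: "'a \<Rightarrow> 'c :: ab_group_add"
  assumes "wf_digraph G" "cycle p"
  shows "(\<Sum>e\<in>set p. f (tail G e) - f (head G e)) = 0"
proof -
  interpret wf_digraph G by fact
  obtain u where u: "awalk u p u" "distinct (tl (awalk_verts u p))"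
    using assms(2) by (auto simp: cycle_def)
  then have "distinct p" by (rule distinct_tl_verts_imp_distinct)
  then have "(\<Sum>e\<in>set p. f (tail G e) - f (head G e)) = (\<Sum>e\<leftarrow>p. f (tail G e) - f (head G e))"
    by (simp add: sum_list_distinct_conv_sum_set)
  also have "\<dots> = 0"
    using u(1) by (subst cas_sum_list_telescope[of u p u]) (auto simp: awalk_def)
  finally show ?thesis .
qed

definition back_indices :: "nat \<Rightarrow> (nat \<times> nat) list \<Rightarrow> nat set" where
  "back_indices k p = {m. m < 2 * (k * k) \<and> back_arc k m \<in> set p}"

lemma finite_back_indices [simp]: "finite (back_indices k p)"
  by (simp add: back_indices_def)

lemma length_cycle_layered_digraph:
  assumes "0 < k" "pre_digraph.cycle (layered_digraph k) p"
  shows "length p = card (back_indices k p) * depth k + set_encode (back_indices k p)"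
proof -
  interpret digraph "layered_digraph k" by (rule digraph_layered_digraph) fact
  let ?I = "back_indices k p"
  from assms(2) obtain u where u: "awalk u p u" "distinct p"
    by (auto simp: cycle_conv)
  then have arcs: "set p \<subseteq> arcs (layered_digraph k)" by auto
  have "int (length p) = (\<Sum>e\<in>set p. 1)"
    using u(2) by (simp add: distinct_card)
  \<comment> \<open>Adding the descents changes nothing, as they sum to zero, but it makes the
    contribution of every forward arc vanish.\<close>
  also have "\<dots> = (\<Sum>e\<in>set p. descent k e + 1)"
    using cycle_sum_potential[OF wf_digraph assms(2), of "\<lambda>v. int (v div k)"]
    by (simp add: descent_def sum.distrib)
  also have "\<dots> = (\<Sum>e\<in>back_arc k ` ?I. descent k e + 1)"
  proof (rule sum.mono_neutral_right)
    show "\<forall>e\<in>set p - back_arc k ` ?I. descent k e + 1 = 0"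
    proof
      fix e assume e: "e \<in> set p - back_arc k ` ?I"
      then have "e \<in> arcs (layered_digraph k)" using arcs by auto
      with assms(1) show "descent k e + 1 = 0"
        by (cases rule: arcs_layered_digraph_cases) (use e in \<open>auto simp: back_indices_def\<close>)
    qed
  qed (auto simp: back_indices_def)
  also have "\<dots> = (\<Sum>m\<in>?I. descent k (back_arc k m) + 1)"
    using inj_on_subset[OF inj_on_back_arc[OF assms(1)], of ?I]
    by (subst sum.reindex) (auto simp: back_indices_def)
  also have "\<dots> = (\<Sum>m\<in>?I. int (depth k) + 2 ^ m)"
    using descent_back_arc[OF assms(1)] by (intro sum.cong) (auto simp: back_indices_def)
  also have "\<dots> = int (card ?I * depth k + set_encode ?I)"
    by (simp add: set_encode_def sum.distrib)
  finally show ?thesis by (simp only: of_nat_eq_iff)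
qed

lemma set_encode_less_two_power:
  assumes "A \<subseteq> {..<n}"
  shows "set_encode A < 2 ^ n"
proof -
  have "set_encode A \<le> (\<Sum>i<n. 2 ^ i)"
    unfolding set_encode_def using assms by (intro sum_mono2) auto
  also have "\<dots> < 2 ^ n"
    by (simp add: sum_power2 lessThan_atLeast0)
  finally show ?thesis .
qed

lemma equal_length_cycles_share_arc:
  assumes "0 < k" "pre_digraph.cycle (layered_digraph k) p" "pre_digraph.cycle (layered_digraph k) q"
    and "length p = length q"
  shows "set p \<inter> set q \<noteq> {}"
proof -
  have code: "length r mod depth k = set_encode (back_indices k r)"
    if "pre_digraph.cycle (layered_digraph k) r" for r
  proof -
    have "set_encode (back_indices k r) < depth k"
      unfolding depth_def by (rule set_encode_less_two_power) (auto simp: back_indices_def)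
    then show ?thesis by (simp add: length_cycle_layered_digraph[OF assms(1) that])
  qed
  have "set_encode (back_indices k p) = set_encode (back_indices k q)"
    using code[OF assms(2)] code[OF assms(3)] assms(4) by simp
  then have eq: "back_indices k p = back_indices k q"
    by (metis finite_back_indices set_encode_inverse)
  \<comment> \<open>Equal index sets only help if they are nonempty: by the length formula, a cycle
    without back arcs would have length 0.\<close>
  have "p \<noteq> []"
    using assms(2) by (auto simp: pre_digraph.cycle_def)
  then have "back_indices k p \<noteq> {}"
    using length_cycle_layered_digraph[OF assms(1,2)] by auto
  with eq show ?thesis by (auto simp: back_indices_def)
qed

section \<open>Strong connectivity after deleting fewer than \<open>k\<close> vertices\<close>

lemma injective_image_avoids_small_set:
  assumes "inj_on f {..<k}" "finite S" "card S < k"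
  shows "\<exists>j<k. f j \<notin> S"
proof (rule ccontr)
  assume "\<not> ?thesis"
  then have "f ` {..<k} \<subseteq> S" by auto
  then have "card (f ` {..<k}) \<le> card S" using assms(2) by (rule card_mono[rotated])
  then show False using assms by (simp add: card_image)
qed

lemma strongly_k_connected_layered_digraph:
  assumes "0 < k"
  shows "strongly_k_connected k (layered_digraph k)"
  unfolding strongly_k_connected_def
proof (intro conjI allI impI)
  \<comment> \<open>Two layers already contain \<open>2 * k\<close>, hence at least
    \<open>k + 1\<close>, vertices.\<close>
  have "1 \<le> depth k" by (simp add: depth_def)
  then have "2 * k \<le> (2 * depth k + 1) * k" by (intro mult_right_mono) auto
  then show "k + 1 \<le> card (verts (layered_digraph k))" using assms by simp
next
  fix S assume "S \<subseteq> verts (layered_digraph k) \<and> card S < k"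
  then have S: "finite S" "card S < k"
    using finite_subset by auto
  define X where "X = verts (layered_digraph k) - S"
  define H where "H = layered_digraph k \<restriction> X"
  interpret D: digraph "layered_digraph k" by (rule digraph_layered_digraph) fact
  interpret H: wf_digraph H unfolding H_def by (rule D.wellformed_induce_subgraph)
  have verts_H: "verts H = X" by (simp add: H_def)
  have X: "v \<in> X \<longleftrightarrow> v div k \<le> 2 * depth k \<and> v \<notin> S" for v
    by (auto simp: X_def layer_less_iff[OF assms, symmetric] simp del: One_nat_def)
  have adj: "u \<rightarrow>\<^bsub>H\<^esub> v" if "(u, v) \<in> arcs (layered_digraph k)" "u \<in> X" "v \<in> X" for u v
    using that by (auto simp: H_def arcs_ends_conv image_iff)
  have survivor: "\<exists>v\<in>X. v div k = l" if "l \<le> 2 * depth k" for l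
  proof -
    have "inj_on (\<lambda>j. l * k + j) {..<k}" by (auto intro: inj_onI)
    then obtain j where "j < k" "l * k + j \<notin> S"
      using injective_image_avoids_small_set S by blast
    then show ?thesis using that by (intro bexI[of _ "l * k + j"]) (auto simp: X)
  qed
  \<comment> \<open>Here \<open>d\<close> is the number of layers strictly between \<open>u\<close>
    and \<open>v\<close>. Each keeps a vertex, and consecutive layers are completely joined.\<close>
  have up: "u \<rightarrow>\<^sup>*\<^bsub>H\<^esub> v" if "u \<in> X" "v \<in> X" "v div k = Suc (u div k + d)" for u v d
    using that
  proof (induction d arbitrary: v)
    case 0
    then have "(u, v) \<in> arcs (layered_digraph k)"
      by (auto simp: layered_digraph_def X_def)
    then show ?case using 0 adj by blast
  next
    case (Suc d)
    then obtain w where w: "w \<in> X" "w div k = Suc (u div k + d)"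
      using survivor[of "Suc (u div k + d)"] by (auto simp: X)
    then have "(w, v) \<in> arcs (layered_digraph k)"
      using Suc by (auto simp: layered_digraph_def X_def)
    then have "w \<rightarrow>\<^bsub>H\<^esub> v" using Suc w adj by blast
    then show ?case using Suc.IH[OF Suc.prems(1) w] by (rule H.reachable_adj_trans[rotated])
  qed
  have climb: "u \<rightarrow>\<^sup>*\<^bsub>H\<^esub> v" if "u \<in> X" "v \<in> X" "u div k < v div k" for u v
    using up[OF that(1,2), of "v div k - Suc (u div k)"] that(3) by simp
  have index: "i * k + j < k * k" if "i < k" "j < k" for i j
    using that div_less_iff_less_mult[OF assms, of "i * k + j" k] by simp
  have mem_arcs: "back_arc k m \<in> arcs (layered_digraph k)" if "m < 2 * (k * k)" for m
    using that by (auto simp: layered_digraph_def)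
  have from_top: "\<exists>w\<in>X. w div k < depth k \<and> u \<rightarrow>\<^sup>*\<^bsub>H\<^esub> w"
    if u: "u \<in> X" "u div k = 2 * depth k" for u
  proof -
    define i where "i = u mod k"
    have i: "i < k" "u = 2 * depth k * k + i"
      using assms u(2) div_mult_mod_eq[of u k] by (auto simp: i_def)
    \<comment> \<open>For \<open>j < k\<close>, these are the indices of the back arcs leaving the
      \<open>i\<close>-th top vertex.\<close>
    let ?m = "\<lambda>j. k * k + (i * k + j)"
    have m: "?m j < 2 * (k * k)" if "j < k" for j using index[OF i(1) that] by simp
    have eq: "back_arc k (?m j) = (u, snd (back_arc k (?m j)))" if "j < k" for j
      using that i by (auto simp: back_arc_def)
    \<comment> \<open>The arcs share the tail \<open>u\<close>, so injectivity of
      \<open>back_arc\<close> forces their heads apart, and \<open>S\<close> cannot contain all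
      \<open>k\<close> of them.\<close>
    have "inj_on (\<lambda>j. snd (back_arc k (?m j))) {..<k}"
    proof (rule inj_onI)
      fix j j' assume j: "j \<in> {..<k}" "j' \<in> {..<k}"
        "snd (back_arc k (?m j)) = snd (back_arc k (?m j'))"
      then have "back_arc k (?m j) = back_arc k (?m j')"
        using eq[of j] eq[of j'] by (simp add: prod_eq_iff)
      then have "?m j = ?m j'" using inj_onD[OF inj_on_back_arc[OF assms]] m j by blast
      then show "j = j'" by simp
    qed
    then obtain j where j: "j < k" "snd (back_arc k (?m j)) \<notin> S"
      using injective_image_avoids_small_set S by blast
    let ?w = "snd (back_arc k (?m j))"
    have "?w \<in> X" using j(2) back_arc_in_verts(2)[OF assms m[OF j(1)]] by (simp add: X_def)
    moreover have "?w div k < depth k"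
    proof -
      \<comment> \<open>Indices of arcs leaving the top are at least \<open>k * k\<close>, hence
        positive, so the power is at least 2 and the head lies strictly below layer
        \<open>depth k\<close>. Index 0, whose power is 1, belongs to an arc into the bottom layer,
        where the weak bound is enough.\<close>
      have "(2::nat) \<le> 2 ^ ?m j" by (rule self_le_power) (use assms in simp_all)
      moreover have "0 < depth k" by (simp add: depth_def)
      ultimately have "depth k + 1 - 2 ^ ?m j < depth k" by linarith
      then show ?thesis using assms by (simp add: back_arc_def)
    qed
    moreover have "u \<rightarrow>\<^bsub>H\<^esub> ?w"
      using adj[of u ?w] mem_arcs[OF m[OF j(1)]] eq[OF j(1)] u(1) \<open>?w \<in> X\<close> by simp
    ultimately show ?thesis by blast
  qed
  have to_bottom: "\<exists>w\<in>X. depth k \<le> w div k \<and> w \<rightarrow>\<^sup>*\<^bsub>H\<^esub> v"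
    if v: "v \<in> X" "v div k = 0" for v
  proof -
    have "v < k" using v(2) assms by (simp add: div_eq_0_iff)
    \<comment> \<open>Dually, these are the indices of the back arcs entering the bottom vertex
      \<open>v\<close>.\<close>
    let ?m = "\<lambda>j. v * k + j"
    have m: "?m j < k * k" "?m j < 2 * (k * k)" if "j < k" for j
      using index[OF \<open>v < k\<close> that] by simp_all
    have eq: "back_arc k (?m j) = (fst (back_arc k (?m j)), v)" if "j < k" for j
      using that m(1)[OF that] by (simp add: back_arc_def)
    have "inj_on (\<lambda>j. fst (back_arc k (?m j))) {..<k}"
    proof (rule inj_onI)
      fix j j' assume j: "j \<in> {..<k}" "j' \<in> {..<k}"
        "fst (back_arc k (?m j)) = fst (back_arc k (?m j'))"
      then have "back_arc k (?m j) = back_arc k (?m j')"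
        using eq[of j] eq[of j'] by (simp add: prod_eq_iff)
      then have "?m j = ?m j'" using inj_onD[OF inj_on_back_arc[OF assms]] m j by blast
      then show "j = j'" by simp
    qed
    then obtain j where j: "j < k" "fst (back_arc k (?m j)) \<notin> S"
      using injective_image_avoids_small_set S by blast
    let ?w = "fst (back_arc k (?m j))"
    have "?w \<in> X" using j(2) back_arc_in_verts(1)[OF assms m(2)[OF j(1)]] by (simp add: X_def)
    moreover have "depth k \<le> ?w div k"
    proof -
      have "(1::nat) \<le> 2 ^ ?m j" by simp
      then have "depth k \<le> depth k + 2 ^ ?m j - 1" by linarith
      then show ?thesis using assms m(1)[OF j(1)] by (simp add: back_arc_def)
    qed
    moreover have "?w \<rightarrow>\<^bsub>H\<^esub> v"
      using adj[of ?w v] mem_arcs[OF m(2)[OF j(1)]] eq[OF j(1)] v(1) \<open>?w \<in> X\<close> by simp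
    ultimately show ?thesis by blast
  qed
  \<comment> \<open>A vertex outside the top layer first climbs to a surviving top vertex;
    \<open>down'\<close> is the dual, through a surviving bottom vertex.\<close>
  have down: "\<exists>w\<in>X. w div k < depth k \<and> u \<rightarrow>\<^sup>*\<^bsub>H\<^esub> w" if "u \<in> X" for u
  proof (cases "u div k = 2 * depth k")
    case False
    obtain t where t: "t \<in> X" "t div k = 2 * depth k" using survivor by blast
    have "u \<rightarrow>\<^sup>*\<^bsub>H\<^esub> t" using climb[OF that t(1)] t(2) False that by (simp add: X)
    then show ?thesis using from_top[OF t] H.reachable_trans by blast
  qed (use that from_top in blast)
  have down': "\<exists>w\<in>X. depth k \<le> w div k \<and> w \<rightarrow>\<^sup>*\<^bsub>H\<^esub> v" if "v \<in> X" for v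
  proof (cases "v div k = 0")
    case False
    obtain b where b: "b \<in> X" "b div k = 0" using survivor[of 0] by blast
    have "b \<rightarrow>\<^sup>*\<^bsub>H\<^esub> v" using climb[OF b(1) that] b(2) False by simp
    then show ?thesis using to_bottom[OF b] H.reachable_trans by blast
  qed (use that to_bottom in blast)
  have "strongly_connected H"
  proof (rule strongly_connectedI)
    show "verts H \<noteq> {}" using survivor[of 0] verts_H by auto
  next
    fix u v assume "u \<in> verts H" "v \<in> verts H"
    then obtain u' v' where "u' \<in> X" "u' div k < depth k" "u \<rightarrow>\<^sup>*\<^bsub>H\<^esub> u'"
      and "v' \<in> X" "depth k \<le> v' div k" "v' \<rightarrow>\<^sup>*\<^bsub>H\<^esub> v"
      using down[of u] down'[of v] verts_H by auto
    \<comment> \<open>The strict bound on the layer of \<open>u'\<close> against the weak one on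
      that of \<open>v'\<close> puts \<open>v'\<close> in a higher layer, as \<open>climb\<close>
      requires.\<close>
    moreover from this have "u' \<rightarrow>\<^sup>*\<^bsub>H\<^esub> v'" by (intro climb) auto
    ultimately show "u \<rightarrow>\<^sup>*\<^bsub>H\<^esub> v" using H.reachable_trans by blast
  qed
  then show "strongly_connected (layered_digraph k \<restriction> (verts (layered_digraph k) - S))"
    by (simp add: H_def X_def)
qed

theorem proposition4:
  fixes k :: nat
  assumes "k \<ge> 1"
  shows "\<exists>D :: (nat, nat \<times> nat) pre_digraph.
           digraph D \<and> strongly_k_connected k D \<and>
           \<not> (\<exists>p q. pre_digraph.cycle D p \<and> pre_digraph.cycle D q \<and>
                    arc_disjoint p q \<and> length p = length q) \<and>
           \<not> (\<exists>p q. pre_digraph.cycle D p \<and> pre_digraph.cycle D q \<and>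
                    vertex_disjoint D p q \<and> length p = length q)"
proof (intro exI[of _ "layered_digraph k"] conjI)
  have k: "0 < k" using assms by simp
  note share = equal_length_cycles_share_arc[OF k]
  show "digraph (layered_digraph k)" using k by (rule digraph_layered_digraph)
  show "strongly_k_connected k (layered_digraph k)" using k by (rule strongly_k_connected_layered_digraph)
  show "\<not> (\<exists>p q. pre_digraph.cycle (layered_digraph k) p \<and> pre_digraph.cycle (layered_digraph k) q \<and>
                  arc_disjoint p q \<and> length p = length q)"
    using share unfolding arc_disjoint_def by blast
  show "\<not> (\<exists>p q. pre_digraph.cycle (layered_digraph k) p \<and> pre_digraph.cycle (layered_digraph k) q \<and>
                  vertex_disjoint (layered_digraph k) p q \<and> length p = length q)"
    \<comment> \<open>A common arc gives a common tail, so vertex-disjoint cycles are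
      arc-disjoint.\<close>
    using share unfolding vertex_disjoint_def walk_verts_def by blast
qed

end
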